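(* Let $1\le p\le\infty$, $r\in\mathbb{N}$, $0<\alpha\le r$. Let the sequence $\{\mathcal{L}_n\}$ of linear Fourier means be bounded in $L_p$, let $w_{\mathcal{L}}\in\Omega_p$, and assume that the following equivalence holds for any $f\in L_p$ and $n\in\mathbb{N}$: $$\|f-\mathcal{L}_n(f)\|_p\asymp w_{\mathcal{L}}\left(f,\tfrac1n\right)_p .$$ Then for any $f\in H_p^{r,\alpha}$ and $n\in\mathbb{N}$ we have $$\|f-\mathcal{L}_n(f)\|_{H_p^{r,\alpha}}\asymp w_{\mathcal{L}}\left(f,\tfrac1n\right)_{H_p^{r,\alpha}} .$$
   Context: $\mathbb{T}\cong[0,2\pi)$ is the torus; functions are complex-valued and $2\pi$-periodic. For $0<p<\infty$, $L_p=L_p(\mathbb{T})$ is the space of measurable functions with $\|f\|_p=\left(\frac1{2\pi}\int_{\mathbb{T}}|f(x)|^p\,dx\right)^{1/p}<\infty$; $L_\infty$ denotes the space of $2\pi$-periodic continuous functions with $\|f\|_\infty=\max|f|$. For $r\in\mathbb{N}=\{1,2,\dots\}$: $\Delta_h^rf(x)=\sum_{\nu=0}^r(-1)^\nu\binom r\nu f(x+\nu h)$. For $0<\alpha\le r$: $f\in H_p^{r,\alpha}$ if $f\in L_p$ and $\|f\|_{H_p^{r,\alpha}}=\|f\|_p+\sup_{h>0}h^{-\alpha}\|\Delta_h^rf\|_p<\infty$. Linear Fourier means: $\mathcal{L}_n(f,x)=\int_{\mathbb{T}}f(t)K_n(x-t)\,dt$, $x\in\mathbb{T}$, with kernels $K_n(x)=\sum_{\nu=-n}^na_{\nu,n}e^{i\nu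 x}$, $a_{0,n}=1$, $n\in\mathbb{N}$. The sequence is bounded in $L_p$ if $\sup_n\sup_{\|f\|_p\le1}\|\mathcal{L}_n(f)\|_p<\infty$. $w\in\Omega_p$ means that $w(\cdot,\cdot)_p$ assigns to each $f\in L_p$ and $\delta>0$ a number $w(f,\delta)_p\ge0$ such that, with a constant $C$ independent of $f,g,\delta$: $w(f,\delta)_p\le C\|f\|_p$ and $w(f+g,\delta)_p\le C(w(f,\delta)_p+w(g,\delta)_p)$ for all $f,g\in L_p$, $\delta>0$. For $w\in\Omega_p$, $$w(f,\delta)_{H_p^{r,\alpha}}=w(f,\delta)_p+\sup_{h>0}\frac{w(\Delta_h^rf,\delta)_p}{h^\alpha}.$$ $A(f,n)\asymp B(f,n)$ means that there are positive constants $c,C$ with $cA(f,n)\le B(f,n)\le CA(f,n)$ for all $f$ and $n$. *)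

theory Defs
  imports "HOL-Analysis.Analysis"
begin

text \<open>
  Functions on the torus are represented by \<open>2\<pi>\<close>-periodic functions on the real line, and elements
  of \<open>L\<^sub>p\<close> by their (pointwise periodic, Lebesgue measurable) representatives. The exponent
  \<open>p\<close> has type \<^typ>\<open>ennreal\<close>, so that \<open>p = \<infinity>\<close> is included; following the source, \<open>L\<^sub>\<infinity>\<close> is the space
  of continuous periodic functions.
\<close>

definition periodic_2pi :: "(real \<Rightarrow> complex) \<Rightarrow> bool" where
  "periodic_2pi f \<longleftrightarrow> (\<forall>x. f (x + 2 * pi) = f x)"

definition Lp_space :: "ennreal \<Rightarrow> (real \<Rightarrow> complex) set" where
  "Lp_space p =
    (if p = \<infinity> then {f. periodic_2pi f \<and> continuous_on UNIV f}
     else {f. periodic_2pi f \<and> f \<in> borel_measurable lebesgue \<and>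
              set_integrable lebesgue {0..<2 * pi} (\<lambda>x. cmod (f x) powr enn2real p)})"

text \<open>Only meaningful on \<^term>\<open>Lp_space p\<close>; there the supremum is a maximum.\<close>

definition Lp_norm :: "ennreal \<Rightarrow> (real \<Rightarrow> complex) \<Rightarrow> real" where
  "Lp_norm p f =
    (if p = \<infinity> then (SUP x. cmod (f x))
     else (1 / (2 * pi) * (LINT x:{0..<2 * pi}|lebesgue. cmod (f x) powr enn2real p))
            powr (1 / enn2real p))"

definition diff_op :: "nat \<Rightarrow> real \<Rightarrow> (real \<Rightarrow> complex) \<Rightarrow> real \<Rightarrow> complex" where
  "diff_op r h f x = (\<Sum>\<nu>=0..r. (-1) ^ \<nu> * of_nat (r choose \<nu>) * f (x + of_nat \<nu> * h))"

text \<open>Suprema over \<open>h > 0\<close> are taken in \<open>[0, \<infinity>]\<close>.\<close>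

definition Holder_norm :: "ennreal \<Rightarrow> nat \<Rightarrow> real \<Rightarrow> (real \<Rightarrow> complex) \<Rightarrow> ennreal" where
  "Holder_norm p r \<alpha> f =
    ennreal (Lp_norm p f) + (SUP h\<in>{0<..}. ennreal (h powr (- \<alpha>) * Lp_norm p (diff_op r h f)))"

definition Holder_space :: "ennreal \<Rightarrow> nat \<Rightarrow> real \<Rightarrow> (real \<Rightarrow> complex) set" where
  "Holder_space p r \<alpha> = {f \<in> Lp_space p. Holder_norm p r \<alpha> f < \<infinity>}"

definition fourier_kernel :: "(int \<Rightarrow> nat \<Rightarrow> complex) \<Rightarrow> nat \<Rightarrow> real \<Rightarrow> complex" where
  "fourier_kernel a n x = (\<Sum>\<nu>=- int n..int n. a \<nu> n * exp (\<i> * of_int \<nu> * of_real x))"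

text \<open>As in the source, the integral carries no factor \<open>1/(2\<pi>)\<close>.\<close>

definition fourier_mean ::
  "(int \<Rightarrow> nat \<Rightarrow> complex) \<Rightarrow> nat \<Rightarrow> (real \<Rightarrow> complex) \<Rightarrow> real \<Rightarrow> complex" where
  "fourier_mean a n f x = (LINT t:{0..<2 * pi}|lebesgue. f t * fourier_kernel a n (x - t))"

definition bounded_in_Lp :: "ennreal \<Rightarrow> (int \<Rightarrow> nat \<Rightarrow> complex) \<Rightarrow> bool" where
  "bounded_in_Lp p a \<longleftrightarrow>
    (SUP n\<in>{1..}. SUP f\<in>{f \<in> Lp_space p. Lp_norm p f \<le> 1}.
       ennreal (Lp_norm p (fourier_mean a n f))) < \<infinity>"

text \<open>
  The class \<open>\<Omega>\<^sub>p\<close>. The almost-everywhere condition says that \<open>w\<close> is a function on \<open>L\<^sub>p\<close>, whose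
  elements are classes of functions equal almost everywhere, and not merely on representatives.
\<close>

definition Omega_class :: "ennreal \<Rightarrow> ((real \<Rightarrow> complex) \<Rightarrow> real \<Rightarrow> real) set" where
  "Omega_class p = {w.
    (\<forall>f\<in>Lp_space p. \<forall>\<delta>>0. 0 \<le> w f \<delta>) \<and>
    (\<forall>f\<in>Lp_space p. \<forall>g\<in>Lp_space p. \<forall>\<delta>>0. (AE x in lebesgue. f x = g x) \<longrightarrow> w f \<delta> = w g \<delta>) \<and>
    (\<exists>C. \<forall>f\<in>Lp_space p. \<forall>g\<in>Lp_space p. \<forall>\<delta>>0.
       w f \<delta> \<le> C * Lp_norm p f \<and>
       w (\<lambda>x. f x + g x) \<delta> \<le> C * (w f \<delta> + w g \<delta>))}"

definition Holder_modulus ::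
  "((real \<Rightarrow> complex) \<Rightarrow> real \<Rightarrow> real) \<Rightarrow> nat \<Rightarrow> real \<Rightarrow> (real \<Rightarrow> complex) \<Rightarrow> real \<Rightarrow> ennreal" where
  "Holder_modulus w r \<alpha> f \<delta> =
    ennreal (w f \<delta>) + (SUP h\<in>{0<..}. ennreal (w (diff_op r h f) \<delta> / h powr \<alpha>))"

end

theory Submission
  imports Defs
begin

text \<open>
  Both sides consist of a term for \<open>f\<close> and a supremum over \<open>h\<close> of terms for the differences \<open>\<Delta>\<^sub>h\<^sup>r f\<close>.
  The difference operator commutes with every Fourier mean, since a convolution operator on the torus
  commutes with translations (\<open>fourier_mean_shift\<close>) and is linear (\<open>fourier_mean_sum\<close>). Hence
  \<open>\<Delta>\<^sub>h\<^sup>r (f - \<L>\<^sub>n f) = \<Delta>\<^sub>h\<^sup>r f - \<L>\<^sub>n (\<Delta>\<^sub>h\<^sup>r f)\<close> (\<open>diff_op_fourier_mean_error\<close>). As \<open>\<Delta>\<^sub>h\<^sup>r f\<close> again lies in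
  \<open>L\<^sub>p\<close> (\<open>diff_op_Lp\<close>), the assumed equivalence applies to \<open>f\<close> and to \<open>\<Delta>\<^sub>h\<^sup>r f\<close>; dividing its instance
  for \<open>\<Delta>\<^sub>h\<^sup>r f\<close> by \<open>h\<^sup>\<alpha>\<close> and taking suprema gives the equivalence of the Hoelder quantities, with the same constants.
\<close>

section \<open>Translation invariance of integrals over a period\<close>

lemma periodic_shift_of_int:
  fixes F :: "real \<Rightarrow> 'b"
  assumes per: "\<And>x. F (x + T) = F x"
  shows "F (x + of_int k * T) = F x"
proof -
  have nat: "F (y + of_nat m * T) = F y" for y and m :: nat
  proof (induction m)
    case (Suc m)
    have "y + of_nat (Suc m) * T = (y + of_nat m * T) + T"
      by (simp add: algebra_simps)
    then show ?case using per Suc by metis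
  qed simp
  show ?thesis
  proof (cases "k \<ge> 0")
    case True
    then show ?thesis using nat[of x "nat k"] by simp
  next
    case False
    then show ?thesis using nat[of "x + of_int k * T" "nat (- k)"] by simp
  qed
qed

lemma lebesgue_measurable_shift:
  fixes s :: real
  shows "(\<lambda>x. x + s) \<in> lebesgue \<rightarrow>\<^sub>M lebesgue"
  using lebesgue_affine_measurable[where c = "\<lambda>_::real. 1" and t = s]
  by (simp add: add.commute)

lemma lebesgue_has_bochner_integral_shift:
  fixes F :: "real \<Rightarrow> 'b::{banach, second_countable_topology}"
  assumes "has_bochner_integral lebesgue F I"
  shows "has_bochner_integral lebesgue (\<lambda>x. F (x + s)) I"
proof -
  have eq: "distr lebesgue lebesgue (\<lambda>x. x + s) = lebesgue"
    using lebesgue_real_affine[of 1 s] by (simp add: add.commute density_1)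
  have F: "F \<in> borel_measurable lebesgue" "integrable lebesgue F" "integral\<^sup>L lebesgue F = I"
    using assms by (auto simp: has_bochner_integral_iff)
  have "integrable lebesgue (\<lambda>x. F (x + s))"
    using integrable_distr_eq[OF lebesgue_measurable_shift[of s] F(1)] F(2) eq by simp
  moreover have "integral\<^sup>L lebesgue (\<lambda>x. F (x + s)) = I"
    using integral_distr[OF lebesgue_measurable_shift[of s] F(1)] F(3) eq by simp
  ultimately show ?thesis
    by (simp add: has_bochner_integral_iff)
qed

lemma
  fixes F :: "real \<Rightarrow> 'b::{banach, second_countable_topology}"
  assumes per: "\<And>x. F (x + 2 * pi) = F x"
    and int: "set_integrable lebesgue {0..<2 * pi} F"
  shows set_integrable_periodic_shift: "set_integrable lebesgue {0..<2 * pi} (\<lambda>x. F (x + s))"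
    and set_integral_periodic_shift:
      "(LINT x:{0..<2 * pi}|lebesgue. F (x + s)) = (LINT x:{0..<2 * pi}|lebesgue. F x)"
proof -
  define k where "k = \<lfloor>s / (2 * pi)\<rfloor>"
  define d where "d = s - of_int k * (2 * pi)"
  have d: "0 \<le> d" "d < 2 * pi"
    using floor_divide_lower[of "2 * pi" s] floor_divide_upper[of "2 * pi" s]
    by (auto simp: d_def k_def algebra_simps)
  have Fs: "F (x + s) = F (x + d)" for x
    using periodic_shift_of_int[of F "2 * pi" "x + d" k, OF per] by (simp add: d_def algebra_simps)
  define g1 where "g1 x = indicator {d..<2 * pi} x *\<^sub>R F x" for x
  define g2 where "g2 x = indicator {0..<d} x *\<^sub>R F x" for x
  have i1: "integrable lebesgue g1"
    using set_integrable_subset[OF int, of "{d..<2 * pi}"] d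
    by (simp add: g1_def[abs_def] set_integrable_def subset_iff)
  have i2: "integrable lebesgue g2"
    using set_integrable_subset[OF int, of "{0..<d}"] d
    by (simp add: g2_def[abs_def] set_integrable_def subset_iff)
  have "has_bochner_integral lebesgue (\<lambda>x. g1 (x + d) + g2 (x + (d - 2 * pi)))
          (integral\<^sup>L lebesgue g1 + integral\<^sup>L lebesgue g2)"
    by (intro has_bochner_integral_add lebesgue_has_bochner_integral_shift
        has_bochner_integral_integrable i1 i2)
  \<comment> \<open>Translating by \<open>d\<close> moves \<open>[0, 2\<pi>)\<close> to \<open>[d, 2\<pi> + d)\<close>, whose part beyond \<open>2\<pi>\<close> folds back onto \<open>[0, d)\<close>.\<close>
  moreover have "g1 (x + d) + g2 (x + (d - 2 * pi)) = indicator {0..<2 * pi} x *\<^sub>R F (x + s)" for x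
  proof -
    have "F (x + (d - 2 * pi)) = F (x + d)"
      using per[of "x + (d - 2 * pi)"] by (simp add: algebra_simps)
    then show ?thesis
      using d by (auto simp: g1_def g2_def Fs indicator_def)
  qed
  moreover have "integral\<^sup>L lebesgue g1 + integral\<^sup>L lebesgue g2 = (LINT x:{0..<2 * pi}|lebesgue. F x)"
    unfolding set_lebesgue_integral_def Bochner_Integration.integral_add[OF i1 i2, symmetric]
    using d by (intro Bochner_Integration.integral_cong) (auto simp: g1_def g2_def indicator_def)
  ultimately have "has_bochner_integral lebesgue (\<lambda>x. indicator {0..<2 * pi} x *\<^sub>R F (x + s))
      (LINT x:{0..<2 * pi}|lebesgue. F x)"
    by simp
  then show "set_integrable lebesgue {0..<2 * pi} (\<lambda>x. F (x + s))"
    and "(LINT x:{0..<2 * pi}|lebesgue. F (x + s)) = (LINT x:{0..<2 * pi}|lebesgue. F x)"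
    by (auto simp: has_bochner_integral_iff set_integrable_def set_lebesgue_integral_def)
qed

section \<open>Closure properties of the spaces of p-integrable functions\<close>

lemma one_le_enn2real:
  assumes "1 \<le> p" "p \<noteq> \<infinity>"
  shows "1 \<le> enn2real p"
  using assms by (cases p) auto

lemma set_borel_measurable_lebesgue:
  fixes F :: "real \<Rightarrow> 'b::{banach, second_countable_topology}"
  assumes "F \<in> borel_measurable lebesgue"
  shows "set_borel_measurable lebesgue {b..<c} F"
  unfolding set_borel_measurable_def
  by (intro borel_measurable_scaleR borel_measurable_indicator assms) simp

lemma Lp_measurable:
  assumes "f \<in> Lp_space p"
  shows "f \<in> borel_measurable lebesgue"
  using assms borel_measurable_continuous_onI[of f]
  by (auto simp: Lp_space_def measurable_completion split: if_splits)

lemma Lp_periodic: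
  assumes "f \<in> Lp_space p"
  shows "f (x + 2 * pi) = f x"
  using assms by (auto simp: Lp_space_def periodic_2pi_def split: if_splits)

lemma Lp_set_integrable:
  assumes p: "1 \<le> p" and f: "f \<in> Lp_space p"
  shows "set_integrable lebesgue {0..<2 * pi} f"
proof (cases "p = \<infinity>")
  case True
  then have "continuous_on {0..2 * pi} f"
    using f by (auto simp: Lp_space_def intro: continuous_on_subset)
  then have "set_integrable lebesgue {0..2 * pi} f"
    by (rule absolutely_integrable_continuous_real)
  then show ?thesis
    by (rule set_integrable_subset) auto
next
  case False
  define q where "q = enn2real p"
  have q: "1 \<le> q" using one_le_enn2real[OF p False] by (simp add: q_def)
  have "set_integrable lebesgue {0..<2 * pi} (\<lambda>x. 1 + cmod (f x) powr q)"
  proof (rule set_integral_add)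
    show "set_integrable lebesgue {0..<2 * pi} (\<lambda>x. 1 :: real)"
      by (auto simp: set_integrable_def)
    show "set_integrable lebesgue {0..<2 * pi} (\<lambda>x. cmod (f x) powr q)"
      using f False by (simp add: Lp_space_def q_def)
  qed
  then show ?thesis
  proof (rule set_integrable_bound)
    show "set_borel_measurable lebesgue {0..<2 * pi} f"
      by (rule set_borel_measurable_lebesgue[OF Lp_measurable[OF f]])
    have "y \<le> 1 + y powr q" if "0 \<le> y" for y :: real
    proof (cases "y \<le> 1")
      case False
      then show ?thesis using powr_mono[of 1 q y] q by simp
    qed (use that in \<open>simp add: add_increasing2\<close>)
    then show "AE x in lebesgue. x \<in> {0..<2 * pi} \<longrightarrow> norm (f x) \<le> norm (1 + cmod (f x) powr q)"
      by simp
  qed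
qed

lemma Lp_shift:
  assumes f: "f \<in> Lp_space p"
  shows "(\<lambda>x. f (x + s)) \<in> Lp_space p"
proof -
  have per: "periodic_2pi (\<lambda>x. f (x + s))"
    using Lp_periodic[OF f, of "x + s" for x] by (simp add: periodic_2pi_def algebra_simps)
  show ?thesis
  proof (cases "p = \<infinity>")
    case True
    then have "continuous_on UNIV (\<lambda>x. f (x + s))"
      using f by (auto simp: Lp_space_def intro!: continuous_on_compose2[of UNIV f] continuous_intros)
    then show ?thesis using per True by (simp add: Lp_space_def)
  next
    case False
    have "(\<lambda>x. f (x + s)) \<in> borel_measurable lebesgue"
      by (rule measurable_compose[OF lebesgue_measurable_shift Lp_measurable[OF f]])
    moreover have "set_integrable lebesgue {0..<2 * pi} (\<lambda>x. cmod (f (x + s)) powr enn2real p)"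
      using f False
      by (intro set_integrable_periodic_shift[where F = "\<lambda>x. cmod (f x) powr enn2real p"])
         (auto simp: Lp_space_def periodic_2pi_def)
    ultimately show ?thesis using per False by (simp add: Lp_space_def)
  qed
qed

lemma Lp_scale:
  assumes f: "f \<in> Lp_space p"
  shows "(\<lambda>x. b * f x) \<in> Lp_space p"
proof (cases "p = \<infinity>")
  case True
  then show ?thesis
    using f by (auto simp: Lp_space_def periodic_2pi_def intro!: continuous_intros)
next
  case False
  have "set_integrable lebesgue {0..<2 * pi}
          (\<lambda>x. cmod b powr enn2real p * cmod (f x) powr enn2real p)"
    using f False by (intro set_integrable_mult_right) (auto simp: Lp_space_def)
  then show ?thesis
    using f False by (auto simp: Lp_space_def periodic_2pi_def norm_mult powr_mult)
qed

lemma Lp_add: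
  assumes f: "f \<in> Lp_space p" and g: "g \<in> Lp_space p"
  shows "(\<lambda>x. f x + g x) \<in> Lp_space p"
proof (cases "p = \<infinity>")
  case True
  then show ?thesis
    using f g by (auto simp: Lp_space_def periodic_2pi_def intro!: continuous_intros)
next
  case False
  define q where "q = enn2real p"
  have q: "0 \<le> q" by (simp add: q_def)
  have meas: "(\<lambda>x. f x + g x) \<in> borel_measurable lebesgue"
    using Lp_measurable[OF f] Lp_measurable[OF g] by (rule borel_measurable_add)
  have "set_integrable lebesgue {0..<2 * pi} (\<lambda>x. 2 powr q * (cmod (f x) powr q + cmod (g x) powr q))"
    using f g False by (intro set_integrable_mult_right set_integral_add) (auto simp: Lp_space_def q_def)
  then have "set_integrable lebesgue {0..<2 * pi} (\<lambda>x. cmod (f x + g x) powr q)"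
  proof (rule set_integrable_bound)
    show "set_borel_measurable lebesgue {0..<2 * pi} (\<lambda>x. cmod (f x + g x) powr q)"
      by (intro set_borel_measurable_lebesgue powr_real_measurable borel_measurable_const
          measurable_compose[OF meas borel_measurable_norm])
    have "cmod (u + v) powr q \<le> 2 powr q * (cmod u powr q + cmod v powr q)" for u v
    proof -
      define m where "m = max (cmod u) (cmod v)"
      have "cmod (u + v) \<le> 2 * m"
        using norm_triangle_ineq[of u v] by (simp add: m_def)
      then have "cmod (u + v) powr q \<le> (2 * m) powr q"
        by (intro powr_mono2 q) auto
      also have "\<dots> = 2 powr q * m powr q"
        by (rule powr_mult)
      also have "m powr q \<le> cmod u powr q + cmod v powr q"
        by (simp add: m_def max_def)
      finally show ?thesis by simp
    qed
    then show "AE x in lebesgue. x \<in> {0..<2 * pi} \<longrightarrow> norm (cmod (f x + g x) powr q)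
        \<le> norm (2 powr q * (cmod (f x) powr q + cmod (g x) powr q))"
      by simp
  qed
  then show ?thesis
    using f g meas False by (auto simp: Lp_space_def periodic_2pi_def q_def)
qed

lemma Lp_sum:
  assumes "finite I" and "\<And>i. i \<in> I \<Longrightarrow> f i \<in> Lp_space p"
  shows "(\<lambda>x. \<Sum>i\<in>I. f i x) \<in> Lp_space p"
  using assms
proof (induction I rule: finite_induct)
  case empty
  show ?case by (simp add: Lp_space_def periodic_2pi_def set_integrable_def)
next
  case (insert i I)
  then show ?case using Lp_add[of "f i" p "\<lambda>x. \<Sum>i\<in>I. f i x"] by simp
qed

lemma diff_op_Lp:
  assumes "f \<in> Lp_space p"
  shows "diff_op r h f \<in> Lp_space p"
proof -
  have "(\<lambda>x. \<Sum>\<nu>=0..r. ((-1) ^ \<nu> * of_nat (r choose \<nu>)) * f (x + of_nat \<nu> * h)) \<in> Lp_space p"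
    by (intro Lp_sum Lp_scale Lp_shift assms) simp
  then show ?thesis
    by (simp add: diff_op_def[abs_def])
qed

section \<open>Fourier means commute with differences\<close>

lemma fourier_kernel_periodic: "fourier_kernel a n (x + 2 * pi) = fourier_kernel a n x"
proof -
  have "exp (\<i> * of_int \<nu> * of_real (x + 2 * pi)) = exp (\<i> * of_int \<nu> * of_real x)" for \<nu>
  proof -
    have "\<i> * of_int \<nu> * of_real (x + 2 * pi)
        = \<i> * of_int \<nu> * of_real x + of_real (of_int (2 * \<nu>) * pi) * \<i>"
      by (simp add: algebra_simps)
    then show ?thesis
      unfolding exp_eq by blast
  qed
  then show ?thesis by (simp add: fourier_kernel_def)
qed

lemma fourier_kernel_bounded: "cmod (fourier_kernel a n x) \<le> (\<Sum>\<nu>=- int n..int n. cmod (a \<nu> n))"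
  unfolding fourier_kernel_def
  by (rule sum_norm_le) (simp add: norm_mult)

lemma fourier_mean_integrable:
  assumes p: "1 \<le> p" and f: "f \<in> Lp_space p"
  shows "set_integrable lebesgue {0..<2 * pi} (\<lambda>t. f t * fourier_kernel a n (x - t))"
proof -
  define B where "B = (\<Sum>\<nu>=- int n..int n. cmod (a \<nu> n))"
  have "continuous_on UNIV (\<lambda>t. fourier_kernel a n (x - t))"
    unfolding fourier_kernel_def by (intro continuous_intros)
  then have K: "(\<lambda>t. fourier_kernel a n (x - t)) \<in> borel_measurable lebesgue"
    using borel_measurable_continuous_onI[of "\<lambda>t. fourier_kernel a n (x - t)"]
    by (simp add: measurable_completion)
  have "set_integrable lebesgue {0..<2 * pi} (\<lambda>t. of_real B * f t)"
    using Lp_set_integrable[OF p f] by simp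
  then show ?thesis
  proof (rule set_integrable_bound)
    show "set_borel_measurable lebesgue {0..<2 * pi} (\<lambda>t. f t * fourier_kernel a n (x - t))"
      by (intro set_borel_measurable_lebesgue borel_measurable_times K Lp_measurable[OF f])
    have "0 \<le> B" by (simp add: B_def sum_nonneg)
    then have "norm (f t * fourier_kernel a n (x - t)) \<le> norm (of_real B * f t)" for t
      using mult_left_mono[OF fourier_kernel_bounded[of a n "x - t"], of "cmod (f t)"]
      by (simp add: norm_mult B_def[symmetric] mult.commute)
    then show "AE t in lebesgue. t \<in> {0..<2 * pi} \<longrightarrow>
        norm (f t * fourier_kernel a n (x - t)) \<le> norm (of_real B * f t)"
      by simp
  qed
qed

lemma fourier_mean_shift:
  assumes p: "1 \<le> p" and f: "f \<in> Lp_space p"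
  shows "fourier_mean a n (\<lambda>x. f (x + s)) x = fourier_mean a n f (x + s)"
proof -
  define F where "F t = f t * fourier_kernel a n (x + s - t)" for t
  have per: "F (t + 2 * pi) = F t" for t
  proof -
    have "x + s - t = x + s - (t + 2 * pi) + 2 * pi" by simp
    then show ?thesis
      using fourier_kernel_periodic[of a n "x + s - (t + 2 * pi)"]
      by (simp only: F_def Lp_periodic[OF f])
  qed
  have int: "set_integrable lebesgue {0..<2 * pi} F"
    unfolding F_def using fourier_mean_integrable[OF p f] .
  have "fourier_mean a n (\<lambda>x. f (x + s)) x = (LINT t:{0..<2 * pi}|lebesgue. F (t + s))"
    by (simp add: fourier_mean_def F_def algebra_simps)
  also have "\<dots> = fourier_mean a n f (x + s)"
    using set_integral_periodic_shift[OF per int, of s] by (simp add: fourier_mean_def F_def)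
  finally show ?thesis .
qed

lemma fourier_mean_sum:
  assumes p: "1 \<le> p" and f: "\<And>i. i \<in> I \<Longrightarrow> f i \<in> Lp_space p"
  shows "fourier_mean a n (\<lambda>x. \<Sum>i\<in>I. b i * f i x) x = (\<Sum>i\<in>I. b i * fourier_mean a n (f i) x)"
proof -
  let ?g = "\<lambda>i t. f i t * fourier_kernel a n (x - t)"
  have int: "integrable lebesgue (\<lambda>t. indicator {0..<2 * pi} t *\<^sub>R ?g i t)" if "i \<in> I" for i
    using fourier_mean_integrable[OF p f[OF that]] by (simp add: set_integrable_def)
  have "fourier_mean a n (\<lambda>x. \<Sum>i\<in>I. b i * f i x) x
      = integral\<^sup>L lebesgue (\<lambda>t. \<Sum>i\<in>I. b i * (indicator {0..<2 * pi} t *\<^sub>R ?g i t))"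
    unfolding fourier_mean_def set_lebesgue_integral_def
    by (intro Bochner_Integration.integral_cong refl)
       (simp add: sum_distrib_right scaleR_sum_right mult.assoc)
  also have "\<dots> = (\<Sum>i\<in>I. integral\<^sup>L lebesgue (\<lambda>t. b i * (indicator {0..<2 * pi} t *\<^sub>R ?g i t)))"
    using int by (intro Bochner_Integration.integral_sum integrable_mult_right)
  also have "\<dots> = (\<Sum>i\<in>I. b i * fourier_mean a n (f i) x)"
    by (simp only: integral_mult_right_zero fourier_mean_def set_lebesgue_integral_def)
  finally show ?thesis .
qed

lemma fourier_mean_diff_op:
  assumes p: "1 \<le> p" and f: "f \<in> Lp_space p"
  shows "fourier_mean a n (diff_op r h f) x = diff_op r h (fourier_mean a n f) x"
  using fourier_mean_sum[OF p, of "{0..r}" "\<lambda>\<nu> x. f (x + of_nat \<nu> * h)" a n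
      "\<lambda>\<nu>. (-1) ^ \<nu> * of_nat (r choose \<nu>)" x] Lp_shift[OF f]
  by (simp add: diff_op_def[abs_def] fourier_mean_shift[OF p f])

lemma diff_op_fourier_mean_error:
  assumes "1 \<le> p" and "f \<in> Lp_space p"
  shows "diff_op r h (\<lambda>x. f x - fourier_mean a n f x)
       = (\<lambda>x. diff_op r h f x - fourier_mean a n (diff_op r h f) x)"
  using fourier_mean_diff_op[OF assms, of a n r h]
  by (simp add: fun_eq_iff diff_op_def right_diff_distrib sum_subtractf)

section \<open>The equivalence in Hoelder spaces\<close>

text \<open>
  Comparison of two quantities of the shape shared by the Hoelder norm and the Hoelder modulus;
  the quantities compared need not be nonnegative, because \<open>ennreal\<close> truncates at zero.
\<close>

lemma ennreal_add_SUP_mono: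
  fixes A B :: real and F G :: "'i \<Rightarrow> real"
  assumes "0 \<le> c" and "c * A \<le> B" and "\<And>i. i \<in> I \<Longrightarrow> c * F i \<le> G i"
  shows "ennreal c * (ennreal A + (SUP i\<in>I. ennreal (F i))) \<le> ennreal B + (SUP i\<in>I. ennreal (G i))"
proof -
  have "ennreal c * (ennreal A + (SUP i\<in>I. ennreal (F i)))
      = ennreal (c * A) + (SUP i\<in>I. ennreal (c * F i))"
    using assms(1) by (simp add: distrib_left SUP_mult_left_ennreal ennreal_mult')
  also have "\<dots> \<le> ennreal B + (SUP i\<in>I. ennreal (G i))"
    using assms by (intro add_mono SUP_mono' ennreal_leI SUP_subset_mono order_refl)
  finally show ?thesis .
qed

lemma ennreal_add_SUP_mono_right:
  fixes A B :: real and F G :: "'i \<Rightarrow> real"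
  assumes "0 \<le> c" and "B \<le> c * A" and "\<And>i. i \<in> I \<Longrightarrow> G i \<le> c * F i"
  shows "ennreal B + (SUP i\<in>I. ennreal (G i)) \<le> ennreal c * (ennreal A + (SUP i\<in>I. ennreal (F i)))"
proof -
  have "ennreal B + (SUP i\<in>I. ennreal (G i)) \<le> ennreal (c * A) + (SUP i\<in>I. ennreal (c * F i))"
    using assms by (intro add_mono ennreal_leI SUP_subset_mono order_refl)
  also have "\<dots> = ennreal c * (ennreal A + (SUP i\<in>I. ennreal (F i)))"
    using assms(1) by (simp add: distrib_left SUP_mult_left_ennreal ennreal_mult')
  finally show ?thesis .
qed

theorem theorem4p2:
  fixes p :: ennreal and r :: nat and \<alpha> :: real
    and a :: "int \<Rightarrow> nat \<Rightarrow> complex"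
    and w :: "(real \<Rightarrow> complex) \<Rightarrow> real \<Rightarrow> real"
  assumes "1 \<le> p" and "1 \<le> r" and "0 < \<alpha>" and "\<alpha> \<le> real r"
    and "\<And>n. 1 \<le> n \<Longrightarrow> a 0 n = 1"
    and "bounded_in_Lp p a"
    and "w \<in> Omega_class p"
    and "\<exists>c>0. \<exists>C>0. \<forall>f\<in>Lp_space p. \<forall>n\<ge>1.
           c * Lp_norm p (\<lambda>x. f x - fourier_mean a n f x) \<le> w f (1 / real n) \<and>
           w f (1 / real n) \<le> C * Lp_norm p (\<lambda>x. f x - fourier_mean a n f x)"
  shows "\<exists>c::real>0. \<exists>C::real>0. \<forall>f\<in>Holder_space p r \<alpha>. \<forall>n\<ge>1.
           ennreal c * Holder_norm p r \<alpha> (\<lambda>x. f x - fourier_mean a n f x)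
             \<le> Holder_modulus w r \<alpha> f (1 / real n) \<and>
           Holder_modulus w r \<alpha> f (1 / real n)
             \<le> ennreal C * Holder_norm p r \<alpha> (\<lambda>x. f x - fourier_mean a n f x)"
proof -
  obtain c C where c: "c > 0" and C: "C > 0" and equiv: "\<forall>f\<in>Lp_space p. \<forall>n\<ge>1.
      c * Lp_norm p (\<lambda>x. f x - fourier_mean a n f x) \<le> w f (1 / real n) \<and>
      w f (1 / real n) \<le> C * Lp_norm p (\<lambda>x. f x - fourier_mean a n f x)"
    using assms(8) by blast
  have "ennreal c * Holder_norm p r \<alpha> (\<lambda>x. f x - fourier_mean a n f x)
          \<le> Holder_modulus w r \<alpha> f (1 / real n) \<and>
        Holder_modulus w r \<alpha> f (1 / real n)
          \<le> ennreal C * Holder_norm p r \<alpha> (\<lambda>x. f x - fourier_mean a n f x)"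
    if "f \<in> Holder_space p r \<alpha>" and n: "1 \<le> n" for f and n :: nat
  proof -
    have f: "f \<in> Lp_space p" using that by (simp add: Holder_space_def)
    let ?E = "\<lambda>g. Lp_norm p (\<lambda>x. g x - fourier_mean a n g x)"
    have lower: "c * ?E g \<le> w g (1 / real n)" and upper: "w g (1 / real n) \<le> C * ?E g"
      if "g \<in> Lp_space p" for g
      using equiv that n by blast+
    have norm_eq: "Holder_norm p r \<alpha> (\<lambda>x. f x - fourier_mean a n f x)
        = ennreal (?E f) + (SUP h\<in>{0<..}. ennreal (?E (diff_op r h f) / h powr \<alpha>))"
      unfolding Holder_norm_def diff_op_fourier_mean_error[OF assms(1) f]
      by (simp add: powr_minus_divide)
    show ?thesis
      unfolding norm_eq Holder_modulus_def
    proof (intro conjI ennreal_add_SUP_mono ennreal_add_SUP_mono_right)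
      show "0 \<le> c" "0 \<le> C" using c C by auto
      show "c * ?E f \<le> w f (1 / real n)" by (rule lower[OF f])
      show "w f (1 / real n) \<le> C * ?E f" by (rule upper[OF f])
    next
      fix h :: real
      have D: "diff_op r h f \<in> Lp_space p" by (rule diff_op_Lp[OF f])
      show "c * (?E (diff_op r h f) / h powr \<alpha>) \<le> w (diff_op r h f) (1 / real n) / h powr \<alpha>"
        using divide_right_mono[OF lower[OF D], of "h powr \<alpha>"] by simp
      show "w (diff_op r h f) (1 / real n) / h powr \<alpha> \<le> C * (?E (diff_op r h f) / h powr \<alpha>)"
        using divide_right_mono[OF upper[OF D], of "h powr \<alpha>"] by simp
    qed
  qed
  then show ?thesis using c C by blast
qed

end
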